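(* Let $a<b$ and let $p,s,q:[a,b]\to\mathbb{R}$ be continuous with $p>0$ on $[a,b]$. Consider the differential equation $$-\left[p(x)(y'(x)+s(x)y(x))\right]'+s(x)p(x)(y'(x)+s(x)y(x))+q(x)y(x)=0 \qquad (\mathrm{E})$$ on $[a,b]$, and the Prüfer system $$r'(x)=r(x)\Big[-\frac{\cos\theta(x)\sin\theta(x)}{p(x)}-s(x)\sin^2\theta(x)+s(x)\cos^2\theta(x)-q(x)\sin\theta(x)\cos\theta(x)\Big],$$ $$\theta'(x)=-\frac{\cos^2\theta(x)}{p(x)}-2s(x)\sin\theta(x)\cos\theta(x)+q(x)\sin^2\theta(x) \qquad (\mathrm{P})$$ on $[a,b]$. (i) If real-valued functions $r$ and $\theta$ solve (P) on $[a,b]$, then the function $y(x)=r(x)\sin\theta(x)$ solves (E) on $[a,b]$. (ii) Conversely, if $y$ is a nontrivial real-valued $C^2$ solution of (E) on $[a,b]$, then there exist functions $r$ and $\theta$ on $[a,b]$ satisfying (P) such that, for all $x\in[a,b]$, $$p(x)\big(y'(x)+s(x)y(x)\big)=-r(x)\cos\theta(x),\qquad y(x)=r(x)\sin\theta(x),$$ and $r(x)\neq 0$.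
   Context: A solution of (E) is a differentiable function $y$ on $[a,b]$ such that the quasi-derivative $p(y'+sy)$ is also differentiable on $[a,b]$ (one-sided derivatives at the endpoints) and the equation holds at every point. A solution is nontrivial if it is not identically zero. *)

theory Defs
  imports "HOL-Analysis.Analysis"
begin

text \<open>Derivative on \<open>[a,b]\<close>, one-sided at the endpoints. As usual for
  \<^const>\<open>vector_derivative\<close>, its value is meaningful only where the function is
  differentiable, so differentiability is always demanded separately below.\<close>

definition derivI :: "real \<Rightarrow> real \<Rightarrow> (real \<Rightarrow> real) \<Rightarrow> real \<Rightarrow> real" where
  "derivI a b f x = vector_derivative f (at x within {a..b})"

definition quasi_deriv ::
  "real \<Rightarrow> real \<Rightarrow> (real \<Rightarrow> real) \<Rightarrow> (real \<Rightarrow> real) \<Rightarrow> (real \<Rightarrow> real) \<Rightarrow> real \<Rightarrow> real" where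
  "quasi_deriv a b p s y x = p x * (derivI a b y x + s x * y x)"

definition solves_E ::
  "real \<Rightarrow> real \<Rightarrow> (real \<Rightarrow> real) \<Rightarrow> (real \<Rightarrow> real) \<Rightarrow> (real \<Rightarrow> real) \<Rightarrow> (real \<Rightarrow> real) \<Rightarrow> bool" where
  "solves_E a b p s q y \<longleftrightarrow>
     y differentiable_on {a..b} \<and>
     quasi_deriv a b p s y differentiable_on {a..b} \<and>
     (\<forall>x\<in>{a..b}. - derivI a b (quasi_deriv a b p s y) x
        + s x * p x * (derivI a b y x + s x * y x) + q x * y x = 0)"

definition solves_P ::
  "real \<Rightarrow> real \<Rightarrow> (real \<Rightarrow> real) \<Rightarrow> (real \<Rightarrow> real) \<Rightarrow> (real \<Rightarrow> real)
     \<Rightarrow> (real \<Rightarrow> real) \<Rightarrow> (real \<Rightarrow> real) \<Rightarrow> bool" where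
  "solves_P a b p s q r \<theta> \<longleftrightarrow>
     r differentiable_on {a..b} \<and>
     \<theta> differentiable_on {a..b} \<and>
     (\<forall>x\<in>{a..b}.
        derivI a b r x = r x * (- (cos (\<theta> x) * sin (\<theta> x) / p x) - s x * (sin (\<theta> x))\<^sup>2
          + s x * (cos (\<theta> x))\<^sup>2 - q x * sin (\<theta> x) * cos (\<theta> x)) \<and>
        derivI a b \<theta> x = - ((cos (\<theta> x))\<^sup>2 / p x) - 2 * s x * sin (\<theta> x) * cos (\<theta> x)
          + q x * (sin (\<theta> x))\<^sup>2)"

text \<open>The library's \<open>C1_differentiable_on\<close> uses two-sided derivatives, which would
  constrain the function outside \<open>[a,b]\<close>.\<close>

definition C2_on_interval :: "real \<Rightarrow> real \<Rightarrow> (real \<Rightarrow> real) \<Rightarrow> bool" where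
  "C2_on_interval a b y \<longleftrightarrow>
     y differentiable_on {a..b} \<and>
     derivI a b y differentiable_on {a..b} \<and>
     continuous_on {a..b} (derivI a b (derivI a b y))"

definition nontrivial_on :: "real \<Rightarrow> real \<Rightarrow> (real \<Rightarrow> real) \<Rightarrow> bool" where
  "nontrivial_on a b y \<longleftrightarrow> (\<exists>x\<in>{a..b}. y x \<noteq> 0)"

end

theory Submission
  imports Defs
begin

text \<open>
  With the quasi-derivative \<open>u = p (y' + s y)\<close> as a second unknown, the equation is the first-order
  linear system \<open>y' = u / p - s y\<close>, \<open>u' = s u + q y\<close>, and the Pruefer system is this
  system written in polar coordinates of the point \<open>- u + \<i> y = r exp (\<i> \<theta>)\<close>.

  From polar to Cartesian coordinates, \<open>y = r sin \<theta>\<close> and \<open>u = - r cos \<theta>\<close> are differentiated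
  by the product rule, and the identity \<open>sin\<^sup>2 + cos\<^sup>2 = 1\<close> turns the result into the linear system
  (lemma \<open>pruefer_imp_linear_system\<close>).

  In the other direction polar coordinates exist only away from the origin. A nontrivial
  solution stays away from it: a solution of a linear system that vanishes at one point vanishes
  everywhere, by a Gronwall estimate for \<open>y\<^sup>2 + u\<^sup>2\<close> (lemma \<open>linear_system_zero\<close>).
  The path \<open>z = - u + \<i> y\<close> is then continuously differentiable and nowhere zero, so it
  has a differentiable logarithm \<open>L\<close> with \<open>L' = z' / z\<close> (lemma \<open>differentiable_path_logarithm\<close>).
  The choice \<open>r = exp (Re L)\<close>, \<open>\<theta> = Im L\<close> gives a positive radius and an
  angle without jumps at once, and the real and imaginary parts of \<open>z' / z\<close> are
  the two right-hand sides of the Pruefer system.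
\<close>

section \<open>One-sided derivatives on an interval\<close>

lemma has_real_derivative_derivI:
  assumes "f differentiable_on {a..b}" "x \<in> {a..b}"
  shows "(f has_real_derivative derivI a b f x) (at x within {a..b})"
  using assms unfolding derivI_def differentiable_on_def
  by (simp add: has_real_derivative_iff_has_vector_derivative vector_derivative_works[symmetric])

lemma derivI_eqI:
  assumes "a < b" "x \<in> {a..b}" "(f has_real_derivative d) (at x within {a..b})"
  shows "derivI a b f x = d"
  using assms unfolding derivI_def
  by (simp add: has_real_derivative_iff_has_vector_derivative
      vector_derivative_within_closed_interval)

lemma differentiable_on_real_derivativeI:
  assumes "\<And>x. x \<in> S \<Longrightarrow> (f has_real_derivative f' x) (at x within S)"
  shows "f differentiable_on S"
  using assms unfolding differentiable_on_def
  by (meson has_field_derivative_imp_has_derivative differentiableI)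

lemma increment_eq_derivative_within:
  fixes f :: "real \<Rightarrow> real"
  assumes "\<And>x. x \<in> {a..b} \<Longrightarrow> (f has_real_derivative f' x) (at x within {a..b})"
    and "a \<le> c" "c \<le> d" "d \<le> b"
  obtains x where "x \<in> {c..d}" "f d - f c = f' x * (d - c)"
proof -
  have "(f has_derivative (*) (f' x)) (at x within {c..d})" if "c \<le> x" "x \<le> d" for x
  proof (rule has_derivative_subset)
    show "(f has_derivative (*) (f' x)) (at x within {a..b})"
      using assms that by (intro has_field_derivative_imp_has_derivative) auto
  qed (use assms in auto)
  from mvt_very_simple[OF \<open>c \<le> d\<close> this] show ?thesis
    using that by auto
qed

section \<open>Solutions of linear systems do not pass through the origin\<close>

text \<open>
  The Gronwall estimate in the form needed here: \<open>w x * exp (- K * x)\<close> decreases and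
  \<open>w x * exp (K * x)\<close> increases, so a zero of \<open>w\<close> propagates to the right by the former and
  to the left by the latter.
\<close>

lemma nonneg_zero_propagates:
  fixes w :: "real \<Rightarrow> real"
  assumes deriv: "\<And>x. x \<in> {a..b} \<Longrightarrow> (w has_real_derivative w' x) (at x within {a..b})"
    and bound: "\<And>x. x \<in> {a..b} \<Longrightarrow> \<bar>w' x\<bar> \<le> K * w x"
    and nonneg: "\<And>x. x \<in> {a..b} \<Longrightarrow> 0 \<le> w x"
    and c: "c \<in> {a..b}" "w c = 0" and d: "d \<in> {a..b}"
  shows "w d = 0"
proof -
  have scaled: "((\<lambda>x. w x * exp (k * x)) has_real_derivative (w' x + k * w x) * exp (k * x))
      (at x within {a..b})" if "x \<in> {a..b}" for x k
    by (rule derivative_eq_intros deriv[OF that] refl | simp add: algebra_simps)+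
  have "w d * exp (k * d) \<le> 0" if k: "k = (if c \<le> d then - K else K)" for k
  proof (cases "c \<le> d")
    case True
    obtain x where x: "x \<in> {c..d}"
      "w d * exp (k * d) - w c * exp (k * c) = (w' x + k * w x) * exp (k * x) * (d - c)"
      using increment_eq_derivative_within[OF scaled, of c d] c d True by auto
    have "w' x + k * w x \<le> 0"
      using bound[of x] x c d True k by auto
    then have "(w' x + k * w x) * (exp (k * x) * (d - c)) \<le> 0"
      using True by (intro mult_nonpos_nonneg) auto
    with x c show ?thesis
      by (simp add: mult.assoc)
  next
    case False
    obtain x where x: "x \<in> {d..c}"
      "w c * exp (k * c) - w d * exp (k * d) = (w' x + k * w x) * exp (k * x) * (c - d)"
      using increment_eq_derivative_within[OF scaled, of d c] c d False by auto
    have "0 \<le> w' x + k * w x"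
      using bound[of x] x c d False k by auto
    then have "0 \<le> (w' x + k * w x) * (exp (k * x) * (c - d))"
      using False by (intro mult_nonneg_nonneg) auto
    with x c show ?thesis
      by (simp add: mult.assoc)
  qed
  then have "w d \<le> 0"
    by (metis exp_gt_zero mult_pos_pos not_le)
  with nonneg[OF d] show ?thesis by simp
qed

lemma continuous_on_Icc_bounded:
  fixes f :: "real \<Rightarrow> real"
  assumes "continuous_on {a..b} f"
  obtains K where "\<And>x. x \<in> {a..b} \<Longrightarrow> f x \<le> K"
proof -
  have "bounded (f ` {a..b})"
    using assms by (intro compact_imp_bounded compact_continuous_image) auto
  then obtain K where "\<forall>x\<in>{a..b}. \<bar>f x\<bar> \<le> K"
    unfolding bounded_iff by auto
  then show ?thesis
    using that[of K] abs_le_D1 by blast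
qed

text \<open>
  For \<open>w = y\<^sup>2 + u\<^sup>2\<close> the system gives \<open>\<bar>w'\<bar> \<le> K w\<close>: the mixed term of \<open>w'\<close> is controlled by
  \<open>\<bar>2 y u\<bar> \<le> w\<close>, and \<open>K\<close> bounds the coefficients, which are continuous on a compact interval.
\<close>

lemma linear_system_zero:
  fixes y u :: "real \<Rightarrow> real"
  assumes cont: "continuous_on {a..b} \<alpha>" "continuous_on {a..b} \<beta>"
      "continuous_on {a..b} \<gamma>" "continuous_on {a..b} \<delta>"
    and y: "\<And>x. x \<in> {a..b} \<Longrightarrow>
      (y has_real_derivative \<alpha> x * y x + \<beta> x * u x) (at x within {a..b})"
    and u: "\<And>x. x \<in> {a..b} \<Longrightarrow>
      (u has_real_derivative \<gamma> x * y x + \<delta> x * u x) (at x within {a..b})"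
    and c: "c \<in> {a..b}" "y c = 0" "u c = 0" and d: "d \<in> {a..b}"
  shows "y d = 0 \<and> u d = 0"
proof -
  define w where "w x = (y x)\<^sup>2 + (u x)\<^sup>2" for x
  define w' where "w' x = 2 * \<alpha> x * (y x)\<^sup>2 + 2 * \<delta> x * (u x)\<^sup>2
    + (\<beta> x + \<gamma> x) * (2 * y x * u x)" for x
  have "continuous_on {a..b} (\<lambda>x. 2 * \<bar>\<alpha> x\<bar> + 2 * \<bar>\<delta> x\<bar> + \<bar>\<beta> x + \<gamma> x\<bar>)"
    by (intro continuous_intros cont)
  then obtain K where K: "\<And>x. x \<in> {a..b} \<Longrightarrow> 2 * \<bar>\<alpha> x\<bar> + 2 * \<bar>\<delta> x\<bar> + \<bar>\<beta> x + \<gamma> x\<bar> \<le> K"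
    by (rule continuous_on_Icc_bounded) blast
  have "(w has_real_derivative w' x) (at x within {a..b})" if "x \<in> {a..b}" for x
    unfolding w_def w'_def
    by (rule derivative_eq_intros y[OF that] u[OF that] refl
        | simp add: algebra_simps power2_eq_square)+
  moreover have "\<bar>w' x\<bar> \<le> K * w x" if x: "x \<in> {a..b}" for x
  proof -
    have "0 \<le> (y x - u x)\<^sup>2" "0 \<le> (y x + u x)\<^sup>2"
      by simp_all
    then have cross: "\<bar>2 * y x * u x\<bar> \<le> w x"
      unfolding w_def by (auto simp: power2_eq_square algebra_simps abs_le_iff)
    have "\<bar>w' x\<bar> \<le> \<bar>2 * \<alpha> x * (y x)\<^sup>2\<bar> + \<bar>2 * \<delta> x * (u x)\<^sup>2\<bar>
        + \<bar>(\<beta> x + \<gamma> x) * (2 * y x * u x)\<bar>"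
      unfolding w'_def by linarith
    also have "\<dots> = 2 * \<bar>\<alpha> x\<bar> * (y x)\<^sup>2 + 2 * \<bar>\<delta> x\<bar> * (u x)\<^sup>2
        + \<bar>\<beta> x + \<gamma> x\<bar> * \<bar>2 * y x * u x\<bar>"
      by (simp add: abs_mult)
    also have "\<dots> \<le> 2 * \<bar>\<alpha> x\<bar> * w x + 2 * \<bar>\<delta> x\<bar> * w x + \<bar>\<beta> x + \<gamma> x\<bar> * w x"
      using cross by (intro add_mono mult_left_mono) (auto simp: w_def)
    also have "\<dots> = (2 * \<bar>\<alpha> x\<bar> + 2 * \<bar>\<delta> x\<bar> + \<bar>\<beta> x + \<gamma> x\<bar>) * w x"
      by (simp add: algebra_simps)
    also have "\<dots> \<le> K * w x"
      using K[OF x] by (intro mult_right_mono) (auto simp: w_def)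
    finally show ?thesis .
  qed
  ultimately have "w d = 0"
    by (rule nonneg_zero_propagates) (use c d in \<open>auto simp: w_def\<close>)
  then show ?thesis
    by (simp add: w_def sum_power2_eq_zero_iff)
qed

section \<open>The logarithm of a nowhere vanishing path\<close>

text \<open>
  The logarithm is an antiderivative of \<open>z' / z\<close> with the right value at \<open>a\<close>: the quotient
  \<open>z / exp L\<close> then has derivative zero and equals one at \<open>a\<close>. No branch of the
  complex logarithm has to be chosen along the path.
\<close>

lemma differentiable_path_logarithm:
  fixes z :: "real \<Rightarrow> complex"
  assumes "a \<le> b" and cont: "continuous_on {a..b} z'"
    and z: "\<And>x. x \<in> {a..b} \<Longrightarrow> (z has_vector_derivative z' x) (at x within {a..b})"
    and nz: "\<And>x. x \<in> {a..b} \<Longrightarrow> z x \<noteq> 0"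
  shows "\<exists>L. \<forall>x\<in>{a..b}.
    (L has_vector_derivative z' x / z x) (at x within {a..b}) \<and> z x = exp (L x)"
proof -
  have "continuous_on {a..b} z"
    using z has_vector_derivative_continuous continuous_on_eq_continuous_within by blast
  then have "continuous_on {a..b} (\<lambda>x. z' x / z x)"
    using cont nz by (intro continuous_on_divide) auto
  then obtain M where M:
    "\<And>x. x \<in> {a..b} \<Longrightarrow> (M has_vector_derivative z' x / z x) (at x within {a..b})"
    by (rule antiderivative_continuous) blast
  define L where "L x = M x + (Ln (z a) - M a)" for x
  have L: "(L has_vector_derivative z' x / z x) (at x within {a..b})" if "x \<in> {a..b}" for x
    unfolding L_def using has_vector_derivative_add[OF M[OF that] has_vector_derivative_const]
    by simp
  have "((\<lambda>x. z x * exp (- L x)) has_vector_derivative 0) (at x within {a..b})"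
    if x: "x \<in> {a..b}" for x
  proof -
    have "((exp \<circ> (\<lambda>x. - L x)) has_vector_derivative - (z' x / z x) * exp (- L x))
        (at x within {a..b})"
      by (intro field_vector_diff_chain_within has_vector_derivative_minus L x
          DERIV_exp has_field_derivative_at_within)
    from has_vector_derivative_mult[OF z[OF x] this] show ?thesis
      using nz[OF x] by (simp add: o_def)
  qed
  then have "\<exists>k. \<forall>x\<in>{a..b}. z x * exp (- L x) = k"
    by (intro has_derivative_zero_constant)
      (auto simp: has_vector_derivative_def)
  moreover have "z a * exp (- L a) = 1"
    using nz[of a] \<open>a \<le> b\<close> by (simp add: L_def exp_minus)
  ultimately have "z x * exp (- L x) = 1" if "x \<in> {a..b}" for x
    using that \<open>a \<le> b\<close> by (metis atLeastAtMost_iff order_refl)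
  then have "z x = exp (L x)" if "x \<in> {a..b}" for x
    using that by (simp add: exp_minus field_simps)
  with L show ?thesis by blast
qed

section \<open>The equation as a linear system\<close>

lemma solves_E_imp_linear_system:
  assumes E: "solves_E a b p s q y" and x: "x \<in> {a..b}" and p: "p x > 0"
  defines "u \<equiv> quasi_deriv a b p s y"
  shows "(y has_real_derivative u x / p x - s x * y x) (at x within {a..b})"
    and "(u has_real_derivative s x * u x + q x * y x) (at x within {a..b})"
proof -
  have "u x / p x - s x * y x = derivI a b y x"
    using p by (simp add: u_def quasi_deriv_def)
  then show "(y has_real_derivative u x / p x - s x * y x) (at x within {a..b})"
    using E x by (simp add: solves_E_def has_real_derivative_derivI)
  have "s x * u x + q x * y x = derivI a b u x"
    using E x by (auto simp: solves_E_def u_def quasi_deriv_def algebra_simps)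
  then show "(u has_real_derivative s x * u x + q x * y x) (at x within {a..b})"
    using E x by (simp add: solves_E_def u_def has_real_derivative_derivI)
qed

lemma linear_system_imp_solves_E:
  assumes "a < b" and p: "\<And>x. x \<in> {a..b} \<Longrightarrow> p x > 0"
    and y: "\<And>x. x \<in> {a..b} \<Longrightarrow>
      (y has_real_derivative u x / p x - s x * y x) (at x within {a..b})"
    and u: "\<And>x. x \<in> {a..b} \<Longrightarrow>
      (u has_real_derivative s x * u x + q x * y x) (at x within {a..b})"
  shows "solves_E a b p s q y"
proof -
  have y': "derivI a b y x = u x / p x - s x * y x" if "x \<in> {a..b}" for x
    using derivI_eqI[OF \<open>a < b\<close> that y[OF that]] .
  have quasi: "quasi_deriv a b p s y x = u x" if "x \<in> {a..b}" for x
    using p[OF that] y'[OF that] by (simp add: quasi_deriv_def)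
  have quasi': "(quasi_deriv a b p s y has_real_derivative s x * u x + q x * y x)
      (at x within {a..b})" if "x \<in> {a..b}" for x
    using has_vector_derivative_transform[OF that quasi] u[OF that]
    by (simp add: has_real_derivative_iff_has_vector_derivative)
  show ?thesis
    unfolding solves_E_def
  proof (intro conjI ballI)
    fix x assume x: "x \<in> {a..b}"
    have "p x * (derivI a b y x + s x * y x) = u x"
      using quasi[OF x] by (simp add: quasi_deriv_def)
    then have "s x * p x * (derivI a b y x + s x * y x) = s x * u x"
      by (simp add: mult.assoc)
    then show "- derivI a b (quasi_deriv a b p s y) x
        + s x * p x * (derivI a b y x + s x * y x) + q x * y x = 0"
      using derivI_eqI[OF \<open>a < b\<close> x quasi'[OF x]] by simp
  qed (rule differentiable_on_real_derivativeI, erule y quasi')+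
qed

section \<open>The Pruefer system in Cartesian coordinates\<close>

text \<open>
  The product rule alone leaves \<open>y' / r\<close> and \<open>u' / r\<close> as cubic forms in \<open>sin \<theta>\<close> and \<open>cos \<theta>\<close>;
  each of them is the wanted linear form times \<open>sin\<^sup>2 \<theta> + cos\<^sup>2 \<theta>\<close>.
\<close>

lemma pruefer_imp_linear_system:
  assumes P: "solves_P a b p s q r \<theta>" and x: "x \<in> {a..b}"
  defines "y \<equiv> \<lambda>x. r x * sin (\<theta> x)" and "u \<equiv> \<lambda>x. - r x * cos (\<theta> x)"
  shows "(y has_real_derivative u x / p x - s x * y x) (at x within {a..b})"
    and "(u has_real_derivative s x * u x + q x * y x) (at x within {a..b})"
proof -
  define S where "S = sin (\<theta> x)"
  define C where "C = cos (\<theta> x)"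
  have unit: "S\<^sup>2 + C\<^sup>2 = 1"
    by (simp add: S_def C_def)
  \<comment> \<open>The system reads \<open>r' = r \<rho>\<close>, \<open>\<theta>' = \<phi>\<close>; here \<open>1 / p\<close> is a
    factor so that the identities below are polynomial.\<close>
  define \<rho> where "\<rho> = - (C * S * inverse (p x)) - s x * S\<^sup>2 + s x * C\<^sup>2 - q x * S * C"
  define \<phi> where "\<phi> = - (C\<^sup>2 * inverse (p x)) - 2 * s x * S * C + q x * S\<^sup>2"
  have r: "(r has_real_derivative r x * \<rho>) (at x within {a..b})"
    and \<theta>: "(\<theta> has_real_derivative \<phi>) (at x within {a..b})"
    using has_real_derivative_derivI[of r a b x] has_real_derivative_derivI[of \<theta> a b x] P x
    unfolding solves_P_def S_def C_def \<rho>_def \<phi>_def by (auto simp: divide_inverse)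
  have y_eq: "\<rho> * S + C * \<phi> = (- (C * inverse (p x)) - s x * S) * (S\<^sup>2 + C\<^sup>2)"
    unfolding \<rho>_def \<phi>_def by (simp add: algebra_simps power2_eq_square)
  have "(y has_real_derivative r x * (\<rho> * S + C * \<phi>)) (at x within {a..b})"
    unfolding y_def S_def C_def
    by (rule derivative_eq_intros r \<theta> refl | simp add: algebra_simps)+
  then show "(y has_real_derivative u x / p x - s x * y x) (at x within {a..b})"
    unfolding y_eq unit by (simp add: y_def u_def S_def C_def divide_inverse algebra_simps)
  have u_eq: "S * \<phi> - \<rho> * C = (q x * S - s x * C) * (S\<^sup>2 + C\<^sup>2)"
    unfolding \<rho>_def \<phi>_def by (simp add: algebra_simps power2_eq_square)
  have "(u has_real_derivative r x * (S * \<phi> - \<rho> * C)) (at x within {a..b})"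
    unfolding u_def S_def C_def
    by (rule derivative_eq_intros r \<theta> refl | simp add: algebra_simps)+
  then show "(u has_real_derivative s x * u x + q x * y x) (at x within {a..b})"
    unfolding u_eq unit by (simp add: y_def u_def S_def C_def algebra_simps)
qed

text \<open>
  Radius and angle both come from one logarithm \<open>L\<close> of \<open>- u + \<i> y\<close>, so the two Pruefer equations
  are the real and the imaginary part of a single identity for \<open>L'\<close>.
\<close>

lemma linear_system_imp_pruefer:
  assumes "a < b" and p: "\<And>x. x \<in> {a..b} \<Longrightarrow> p x > 0"
    and cont: "continuous_on {a..b} p" "continuous_on {a..b} s" "continuous_on {a..b} q"
    and y: "\<And>x. x \<in> {a..b} \<Longrightarrow>
      (y has_real_derivative u x / p x - s x * y x) (at x within {a..b})"
    and u: "\<And>x. x \<in> {a..b} \<Longrightarrow>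
      (u has_real_derivative s x * u x + q x * y x) (at x within {a..b})"
    and nz: "\<And>x. x \<in> {a..b} \<Longrightarrow> y x \<noteq> 0 \<or> u x \<noteq> 0"
  shows "\<exists>r \<theta>. solves_P a b p s q r \<theta> \<and>
    (\<forall>x\<in>{a..b}. u x = - r x * cos (\<theta> x) \<and> y x = r x * sin (\<theta> x) \<and> r x > 0)"
proof -
  define z where "z x = Complex (- u x) (y x)" for x
  define z' where "z' x = Complex (- (s x * u x + q x * y x)) (u x / p x - s x * y x)" for x
  have cont_yu: "continuous_on {a..b} y" "continuous_on {a..b} u"
    by (rule DERIV_continuous_on, erule y u)+
  have "continuous_on {a..b} z'"
    unfolding z'_def Complex_eq using p
    by (intro continuous_intros cont cont_yu) force
  moreover have "(z has_vector_derivative z' x) (at x within {a..b})" if "x \<in> {a..b}" for x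
    using y[OF that] DERIV_minus[OF u[OF that]] unfolding z_def z'_def
    by (simp add: has_vector_derivative_complex_iff)
  moreover have "z x \<noteq> 0" if "x \<in> {a..b}" for x
    using nz[OF that] by (auto simp: z_def complex_eq_iff)
  ultimately have "\<exists>L. \<forall>x\<in>{a..b}.
      (L has_vector_derivative z' x / z x) (at x within {a..b}) \<and> z x = exp (L x)"
    by (rule differentiable_path_logarithm[OF less_imp_le[OF \<open>a < b\<close>]])
  then obtain L where
    L: "\<And>x. x \<in> {a..b} \<Longrightarrow> (L has_vector_derivative z' x / z x) (at x within {a..b})"
    and zL: "\<And>x. x \<in> {a..b} \<Longrightarrow> z x = exp (L x)"
    by blast
  define r where "r x = exp (Re (L x))" for x
  define \<theta> where "\<theta> x = Im (L x)" for x
  have u_polar: "u x = - r x * cos (\<theta> x)" and y_polar: "y x = r x * sin (\<theta> x)"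
    if "x \<in> {a..b}" for x
    using zL[OF that] by (auto simp: z_def r_def \<theta>_def complex_eq_iff Re_exp Im_exp)
  define \<rho> where "\<rho> x = - (cos (\<theta> x) * sin (\<theta> x) / p x) - s x * (sin (\<theta> x))\<^sup>2
    + s x * (cos (\<theta> x))\<^sup>2 - q x * sin (\<theta> x) * cos (\<theta> x)" for x
  define \<phi> where "\<phi> x = - ((cos (\<theta> x))\<^sup>2 / p x) - 2 * s x * sin (\<theta> x) * cos (\<theta> x)
    + q x * (sin (\<theta> x))\<^sup>2" for x
  have quotient: "z' x / z x = Complex (\<rho> x) (\<phi> x)" if x: "x \<in> {a..b}" for x
  proof -
    have "r x \<noteq> 0" by (simp add: r_def)
    \<comment> \<open>Both \<open>z'\<close> and \<open>z\<close> carry the factor \<open>r\<close>; it cancels, and what remains of the division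
      is a rotation by \<open>- \<theta>\<close>.\<close>
    have "z' x = of_real (r x) * Complex (s x * cos (\<theta> x) - q x * sin (\<theta> x))
        (- (cos (\<theta> x) / p x) - s x * sin (\<theta> x))"
      by (simp add: z'_def u_polar[OF x] y_polar[OF x] complex_eq_iff algebra_simps)
    moreover have "z x = of_real (r x) * cis (\<theta> x)"
      by (simp add: z_def u_polar[OF x] y_polar[OF x] complex_eq_iff)
    ultimately have "z' x / z x = Complex (s x * cos (\<theta> x) - q x * sin (\<theta> x))
        (- (cos (\<theta> x) / p x) - s x * sin (\<theta> x)) / cis (\<theta> x)"
      using \<open>r x \<noteq> 0\<close> by simp
    then have "z' x / z x = Complex (s x * cos (\<theta> x) - q x * sin (\<theta> x))
        (- (cos (\<theta> x) / p x) - s x * sin (\<theta> x)) * cis (- \<theta> x)"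
      by (simp only: divide_inverse cis_inverse)
    then show ?thesis
      by (simp add: complex_eq_iff \<rho>_def \<phi>_def algebra_simps power2_eq_square)
  qed
  have ReL: "((\<lambda>x. Re (L x)) has_real_derivative \<rho> x) (at x within {a..b})"
    and \<theta>': "(\<theta> has_real_derivative \<phi> x) (at x within {a..b})" if "x \<in> {a..b}" for x
    using L[OF that] unfolding quotient[OF that] \<theta>_def
    by (simp_all add: has_vector_derivative_complex_iff)
  have r': "(r has_real_derivative r x * \<rho> x) (at x within {a..b})" if "x \<in> {a..b}" for x
    unfolding r_def by (rule derivative_eq_intros ReL[OF that] refl | simp)+
  have "solves_P a b p s q r \<theta>"
    unfolding solves_P_def
  proof (intro conjI ballI)
    fix x assume x: "x \<in> {a..b}"
    show "derivI a b r x = r x * (- (cos (\<theta> x) * sin (\<theta> x) / p x) - s x * (sin (\<theta> x))\<^sup>2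
          + s x * (cos (\<theta> x))\<^sup>2 - q x * sin (\<theta> x) * cos (\<theta> x))"
      using derivI_eqI[OF \<open>a < b\<close> x r'[OF x]] by (simp add: \<rho>_def)
    show "derivI a b \<theta> x = - ((cos (\<theta> x))\<^sup>2 / p x) - 2 * s x * sin (\<theta> x) * cos (\<theta> x)
          + q x * (sin (\<theta> x))\<^sup>2"
      using derivI_eqI[OF \<open>a < b\<close> x \<theta>'[OF x]] by (simp add: \<phi>_def)
  qed (rule differentiable_on_real_derivativeI, erule r' \<theta>')+
  moreover have "r x > 0" for x
    by (simp add: r_def)
  ultimately show ?thesis
    using u_polar y_polar by blast
qed

section \<open>The Pruefer transformation\<close>

theorem theorem2p1:
  fixes a b :: real and p s q :: "real \<Rightarrow> real"
  assumes "a < b"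
    and "continuous_on {a..b} p"
    and "continuous_on {a..b} s"
    and "continuous_on {a..b} q"
    and "\<forall>x\<in>{a..b}. p x > 0"
  shows "(\<forall>r \<theta> :: real \<Rightarrow> real. solves_P a b p s q r \<theta> \<longrightarrow>
            solves_E a b p s q (\<lambda>x. r x * sin (\<theta> x))) \<and>
         (\<forall>y :: real \<Rightarrow> real.
            solves_E a b p s q y \<and> nontrivial_on a b y \<and> C2_on_interval a b y \<longrightarrow>
            (\<exists>r \<theta> :: real \<Rightarrow> real. solves_P a b p s q r \<theta> \<and>
               (\<forall>x\<in>{a..b}.
                  p x * (derivI a b y x + s x * y x) = - r x * cos (\<theta> x) \<and>
                  y x = r x * sin (\<theta> x) \<and>
                  r x \<noteq> 0)))"
proof (intro conjI allI impI)
  fix r \<theta> :: "real \<Rightarrow> real"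
  assume "solves_P a b p s q r \<theta>"
  note system = pruefer_imp_linear_system[OF this]
  show "solves_E a b p s q (\<lambda>x. r x * sin (\<theta> x))"
    by (rule linear_system_imp_solves_E[OF assms(1) _ system]) (use assms(5) in blast)
next
  fix y :: "real \<Rightarrow> real"
  assume y: "solves_E a b p s q y \<and> nontrivial_on a b y \<and> C2_on_interval a b y"
  define u where "u = quasi_deriv a b p s y"
  have p: "p x > 0" if "x \<in> {a..b}" for x
    using assms(5) that by blast
  have sys: "(y has_real_derivative u x / p x - s x * y x) (at x within {a..b})"
    "(u has_real_derivative s x * u x + q x * y x) (at x within {a..b})"
    if "x \<in> {a..b}" for x
    using solves_E_imp_linear_system[of a b p s q y x] y that p unfolding u_def by auto
  have nz: "y x \<noteq> 0 \<or> u x \<noteq> 0" if x: "x \<in> {a..b}" for x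
  proof (rule ccontr)
    assume "\<not> (y x \<noteq> 0 \<or> u x \<noteq> 0)"
    then have zero: "y x = 0" "u x = 0" by auto
    have "y t = 0 \<and> u t = 0" if t: "t \<in> {a..b}" for t
    proof (rule linear_system_zero[where \<alpha> = "\<lambda>x. - s x" and \<beta> = "\<lambda>x. 1 / p x"
            and \<gamma> = q and \<delta> = s and y = y and u = u and c = x])
      show "continuous_on {a..b} (\<lambda>x. - s x)" "continuous_on {a..b} (\<lambda>x. 1 / p x)"
        using p by (intro continuous_intros assms; force)+
      show "(y has_real_derivative - s x * y x + 1 / p x * u x) (at x within {a..b})"
        "(u has_real_derivative q x * y x + s x * u x) (at x within {a..b})"
        if "x \<in> {a..b}" for x
        using sys[OF that] by (simp_all add: algebra_simps)
    qed (use assms x t zero in auto)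
    with y show False
      unfolding nontrivial_on_def by blast
  qed
  have "\<exists>r \<theta>. solves_P a b p s q r \<theta> \<and>
    (\<forall>x\<in>{a..b}. u x = - r x * cos (\<theta> x) \<and> y x = r x * sin (\<theta> x) \<and> r x > 0)"
    by (rule linear_system_imp_pruefer[OF assms(1) _ assms(2-4)]) (erule p sys nz)+
  then show "\<exists>r \<theta>. solves_P a b p s q r \<theta> \<and>
      (\<forall>x\<in>{a..b}. p x * (derivI a b y x + s x * y x) = - r x * cos (\<theta> x) \<and>
        y x = r x * sin (\<theta> x) \<and> r x \<noteq> 0)"
    unfolding u_def quasi_deriv_def by (metis less_irrefl)
qed

end
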